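(* Let $R$ be a regular quantum commutative algebra of quantum length $m$ with regular quantum commutation function $\theta$, and suppose that $\operatorname{char}(K)=0$. Then all $\theta(i,j)$, $1\le i,j\le m$, are roots of unity.
   Context: $K$ is an algebraically closed field of characteristic different from $2$; all algebras are unital associative $K$-algebras (not assumed finite-dimensional). A regular quantum commutative decomposition of an algebra $R$, of quantum length $m$, is a vector space decomposition $R=R_1\oplus\cdots\oplus R_m$ such that, with $S=\{1,\dots,m\}$: (a) for every $n\in\mathbb{N}$ and every $(i_1,\dots,i_n)\in S^n$ there exist $a_j\in R_{i_j}$, $1\le j\le n$, with $a_1\cdots a_n\neq 0$; (b) there is a function $\theta\colon S\times S\to K^*$ (the regular quantum commutation function) such that $ab=\theta(i,j)ba$ for all $i,j\in S$, $a\in R_i$, $b\in R_j$. An algebra with a fixed such decomposition and $\theta$ is called a regular quantum commutative algebra. *)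

theory Defs
  imports "HOL-Computational_Algebra.Computational_Algebra"
begin

locale unital_algebra = vector_space scale
  for scale :: "'k::field \<Rightarrow> 'r::ring_1 \<Rightarrow> 'r" (infixr \<open>*s\<close> 75) +
  assumes scale_mult_left: "(c *s a) * b = c *s (a * b)"
    and scale_mult_right: "a * (c *s b) = c *s (a * b)"
begin

definition direct_sum_decomposition :: "'i set \<Rightarrow> ('i \<Rightarrow> 'r set) \<Rightarrow> bool" where
  "direct_sum_decomposition S R \<longleftrightarrow>
     finite S \<and> (\<forall>i\<in>S. subspace (R i)) \<and>
     (\<forall>x. \<exists>!r. r \<in> Pi\<^sub>E S R \<and> x = (\<Sum>i\<in>S. r i))"

end

text \<open>The components \<^term>\<open>R i\<close> need not form a grading: nothing is assumed
  about where products of elements of two components lie. Only the values of \<^term>\<open>R\<close>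
  and \<^term>\<open>\<theta>\<close> at indices in \<^term>\<open>{1..m}\<close> matter.\<close>

locale regular_quantum_commutative_algebra = unital_algebra scale
  for scale :: "'k::field \<Rightarrow> 'r::ring_1 \<Rightarrow> 'r" (infixr \<open>*s\<close> 75) +
  fixes m :: nat and R :: "nat \<Rightarrow> 'r set" and \<theta> :: "nat \<Rightarrow> nat \<Rightarrow> 'k"
  assumes decomposition: "direct_sum_decomposition {1..m} R"
    and regular: "set is \<subseteq> {1..m} \<Longrightarrow>
           \<exists>as. list_all2 (\<lambda>i a. a \<in> R i) is as \<and> prod_list as \<noteq> 0"
    and theta_nonzero: "i \<in> {1..m} \<Longrightarrow> j \<in> {1..m} \<Longrightarrow> \<theta> i j \<noteq> 0"
    and quantum_commute: "i \<in> {1..m} \<Longrightarrow> j \<in> {1..m} \<Longrightarrow> a \<in> R i \<Longrightarrow> b \<in> R j \<Longrightarrow>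
           a * b = \<theta> i j *s (b * a)"

definition root_of_unity :: "'a::monoid_mult \<Rightarrow> bool" where
  "root_of_unity x \<longleftrightarrow> (\<exists>n>0. x ^ n = 1)"

end

theory Submission
  imports Defs
begin

text \<open>Fix indices \<open>i\<close>, \<open>j\<close> and put \<open>t k = \<theta> k j\<close>, so that an element of \<open>R k\<close> commutes
  with the elements of \<open>R j\<close> up to the factor \<open>t k\<close>. A product \<open>w\<close> of \<open>n\<close> elements of
  \<open>R i\<close> may lie anywhere in the algebra, but it commutes with the elements of \<open>R j\<close> up to the
  single factor \<open>(t i)^n\<close>. Comparing \<open>w\<close> with its components in the direct sum is an
  eigenvalue argument: if \<open>(t i)^n\<close> is none of the finitely many values \<open>t k\<close>, then \<open>w\<close> is
  killed by every product of \<open>m\<close> elements of \<open>R j\<close> (\<open>skew_eigenvector_annihilated\<close>).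
  This contradicts regularity for the index sequence consisting of \<open>m\<close> times \<open>j\<close> and then
  \<open>n\<close> times \<open>i\<close>. Hence every power of \<open>\<theta> i j\<close> lies in the finite set of the \<open>\<theta> k j\<close>,
  two of them coincide, and \<open>\<theta> i j\<close>, being nonzero, is a root of unity.\<close>

context unital_algebra
begin

lemma skew_commute_prod_list_right:
  assumes "\<And>b. b \<in> set bs \<Longrightarrow> a * b = c *s (b * a)"
  shows "a * prod_list bs = c ^ length bs *s (prod_list bs * a)"
  using assms
proof (induction bs)
  case (Cons b bs)
  have "a * prod_list (b # bs) = c *s (b * (a * prod_list bs))"
    using Cons.prems[of b] by (simp add: mult.assoc[symmetric] scale_mult_left)
  also have "a * prod_list bs = c ^ length bs *s (prod_list bs * a)"
    using Cons by simp
  finally show ?case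
    by (simp add: scale_mult_right mult.assoc)
qed simp

lemma skew_commute_prod_list_left:
  assumes "\<And>a. a \<in> set as \<Longrightarrow> a * b = c *s (b * a)"
  shows "prod_list as * b = c ^ length as *s (b * prod_list as)"
  using assms
proof (induction as)
  case (Cons a as)
  have "prod_list (a # as) * b = a * (prod_list as * b)"
    by (simp add: mult.assoc)
  also have "prod_list as * b = c ^ length as *s (b * prod_list as)"
    using Cons by simp
  also have "a * \<dots> = c ^ length as *s (a * b * prod_list as)"
    by (simp add: scale_mult_right mult.assoc)
  also have "a * b = c *s (b * a)"
    using Cons.prems by simp
  finally show ?case
    by (simp add: scale_mult_left mult.assoc mult.commute)
qed simp

text \<open>The analogue of the linear independence of eigenvectors for different eigenvalues.
  Let \<open>Z\<close> be the product of \<open>zs\<close>, split as \<open>Z = U * V\<close> with \<open>s\<close> factors in \<open>V\<close>. Moving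
  only \<open>V\<close> across turns \<open>U * x k * V\<close> into \<open>(t k)^s\<close> times \<open>Z * x k\<close>, while the same move
  for the sum gives the factor \<open>\<mu>^s\<close>. So the powers of the eigenvalues act on one and the
  same family \<open>Z * x k\<close>, and linear combinations over \<open>s \<le> length zs\<close> yield the polynomials
  of at most this degree. The one with the roots \<open>t k\<close> kills every \<open>Z * x k\<close> but not the
  factor of the sum; it has degree \<open>card I\<close>, whence the bound on the length.\<close>

lemma skew_eigenvector_annihilated:
  assumes fin: "finite I" and len: "card I \<le> length zs"
    and comp: "\<And>k z. k \<in> I \<Longrightarrow> z \<in> set zs \<Longrightarrow> x k * z = t k *s (z * x k)"
    and total: "\<And>z. z \<in> set zs \<Longrightarrow> (\<Sum>k\<in>I. x k) * z = \<mu> *s (z * (\<Sum>k\<in>I. x k))"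
    and new: "\<mu> \<notin> t ` I"
  shows "prod_list zs * (\<Sum>k\<in>I. x k) = 0"
proof -
  define w where "w = (\<Sum>k\<in>I. x k)"
  define Z where "Z = prod_list zs"
  define p where "p = (\<Prod>k\<in>I. [:- t k, 1:])"
  have power: "(\<Sum>k\<in>I. t k ^ s *s (Z * x k)) = \<mu> ^ s *s (Z * w)" if s: "s \<le> length zs" for s
  proof -
    define us vs where "us = take (length zs - s) zs" and "vs = drop (length zs - s) zs"
    have zs: "zs = us @ vs" and vs: "length vs = s" "set vs \<subseteq> set zs"
      using s by (simp_all add: us_def vs_def set_drop_subset)
    have Z: "Z = prod_list us * prod_list vs"
      by (simp add: Z_def zs)
    have "prod_list us * (x k * prod_list vs) = t k ^ s *s (Z * x k)" if "k \<in> I" for k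
      using skew_commute_prod_list_right[of vs "x k" "t k"] comp[OF that] vs
      by (auto simp: Z scale_mult_right mult.assoc subset_iff)
    moreover have "prod_list us * (w * prod_list vs) = \<mu> ^ s *s (Z * w)"
      using skew_commute_prod_list_right[of vs w \<mu>] total vs
      by (auto simp: Z w_def scale_mult_right mult.assoc subset_iff)
    moreover have "prod_list us * (w * prod_list vs)
        = (\<Sum>k\<in>I. prod_list us * (x k * prod_list vs))"
      by (simp add: w_def sum_distrib_left sum_distrib_right)
    ultimately show ?thesis
      by simp
  qed
  have "degree p \<le> length zs"
    using degree_prod_sum_le[OF fin, of "\<lambda>k. [:- t k, 1:]"] len by (simp add: p_def)
  then have "poly p \<mu> *s (Z * w)
      = (\<Sum>s\<le>degree p. coeff p s *s (\<Sum>k\<in>I. t k ^ s *s (Z * x k)))"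
    by (simp add: poly_altdef scale_sum_left power)
  also have "\<dots> = (\<Sum>k\<in>I. poly p (t k) *s (Z * x k))"
    by (simp add: poly_altdef scale_sum_left scale_sum_right sum.swap[of _ I])
  also have "\<dots> = 0"
    using fin by (intro sum.neutral) (auto simp: p_def poly_prod)
  finally have "poly p \<mu> *s (Z * w) = 0" .
  moreover have "poly p \<mu> \<noteq> 0"
    using new fin by (auto simp: p_def poly_prod)
  ultimately show ?thesis
    by (simp add: Z_def w_def)
qed

end

context regular_quantum_commutative_algebra
begin

lemma sum_of_components:
  obtains r where "\<And>k. k \<in> {1..m} \<Longrightarrow> r k \<in> R k" "x = (\<Sum>k\<in>{1..m}. r k)"
proof -
  obtain r where "r \<in> Pi\<^sub>E {1..m} R" "x = (\<Sum>k\<in>{1..m}. r k)"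
    using decomposition unfolding direct_sum_decomposition_def by blast
  then show thesis
    using that[of r] by (meson PiE_mem)
qed

lemma theta_power_in_column:
  assumes i: "i \<in> {1..m}" and j: "j \<in> {1..m}"
  shows "\<theta> i j ^ n \<in> (\<lambda>k. \<theta> k j) ` {1..m}"
proof (rule ccontr)
  assume new: "\<theta> i j ^ n \<notin> (\<lambda>k. \<theta> k j) ` {1..m}"
  have "set (replicate m j @ replicate n i) \<subseteq> {1..m}"
    using i j by auto
  from regular[OF this] obtain zs as
    where zs: "list_all2 (\<lambda>i a. a \<in> R i) (replicate m j) zs"
      and as: "list_all2 (\<lambda>i a. a \<in> R i) (replicate n i) as"
      and nonzero: "prod_list zs * prod_list as \<noteq> 0"
    by (auto simp: list_all2_append1)
  have zs: "length zs = m" "\<And>z. z \<in> set zs \<Longrightarrow> z \<in> R j"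
    using zs by (auto simp: list_all2_conv_all_nth in_set_conv_nth)
  have as: "length as = n" "\<And>a. a \<in> set as \<Longrightarrow> a \<in> R i"
    using as by (auto simp: list_all2_conv_all_nth in_set_conv_nth)
  obtain r where r: "\<And>k. k \<in> {1..m} \<Longrightarrow> r k \<in> R k" "prod_list as = (\<Sum>k\<in>{1..m}. r k)"
    using sum_of_components by blast
  have "prod_list zs * (\<Sum>k\<in>{1..m}. r k) = 0"
  proof (rule skew_eigenvector_annihilated)
    show "r k * z = \<theta> k j *s (z * r k)" if "k \<in> {1..m}" "z \<in> set zs" for k z
      using that j r(1) zs(2) by (intro quantum_commute)
    show "(\<Sum>k\<in>{1..m}. r k) * z = \<theta> i j ^ n *s (z * (\<Sum>k\<in>{1..m}. r k))" if "z \<in> set zs" for z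
      using skew_commute_prod_list_left[of as z "\<theta> i j"] quantum_commute[OF i j] as zs(2)[OF that]
      by (simp add: r(2))
  qed (use zs(1) new in simp_all)
  with nonzero show False
    by (simp add: r(2))
qed

end

lemma root_of_unity_if_finitely_many_powers:
  fixes x :: "'a::field"
  assumes "x \<noteq> 0" "finite (range (\<lambda>n::nat. x ^ n))"
  shows "root_of_unity x"
proof -
  have "\<not> inj (\<lambda>n::nat. x ^ n)"
    using assms(2) finite_imageD infinite_UNIV_nat by blast
  then obtain a b :: nat where "a < b" "x ^ a = x ^ b"
    unfolding inj_def by (metis linorder_neqE_nat)
  moreover from \<open>a < b\<close> have "x ^ b = x ^ a * x ^ (b - a)"
    by (simp flip: power_add)
  ultimately show ?thesis
    using assms(1) by (auto simp: root_of_unity_def intro!: exI[of _ "b - a"])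
qed

theorem theorem27:
  fixes scale :: "'k::alg_closed_field \<Rightarrow> 'r::ring_1 \<Rightarrow> 'r"
    and m :: nat and R :: "nat \<Rightarrow> 'r set" and \<theta> :: "nat \<Rightarrow> nat \<Rightarrow> 'k"
  assumes "regular_quantum_commutative_algebra scale m R \<theta>"
    and "CHAR('k) = 0"
  shows "\<forall>i\<in>{1..m}. \<forall>j\<in>{1..m}. root_of_unity (\<theta> i j)"
proof (intro ballI)
  fix i j assume ij: "i \<in> {1..m}" "j \<in> {1..m}"
  interpret regular_quantum_commutative_algebra scale m R \<theta>
    by fact
  have "range (\<lambda>n. \<theta> i j ^ n) \<subseteq> (\<lambda>k. \<theta> k j) ` {1..m}"
    using theta_power_in_column[OF ij] by blast
  then have "finite (range (\<lambda>n. \<theta> i j ^ n))"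
    by (rule finite_subset) simp
  with theta_nonzero[OF ij] show "root_of_unity (\<theta> i j)"
    by (rule root_of_unity_if_finitely_many_powers)
qed

end
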